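(* Let $\mathbf U_h(t)$, with nodal values $\mathbf U_{i_1}^i(t)\in\mathscr G$, be a solution of the one-dimensional semi-discrete nodal DG scheme described in the context, and assume the boundary conditions are periodic or compactly supported. Then the scheme is entropy conservative in each single element, in the sense that for every $i$ $$\frac{\mathrm d}{\mathrm dt}\Big(\sum_{i_1=0}^k\frac{\omega_{i_1}\Delta x}2\,\mathcal U(\mathbf U_{i_1}^i)\Big)=-\big(\mathcal F_k^{*,i}-\mathcal F_0^{*,i}\big),$$ and entropy stable in $\Omega$, in the sense that $$\frac{\mathrm d}{\mathrm dt}\Big(\sum_{i=1}^N\sum_{i_1=0}^k\frac{\omega_{i_1}\Delta x}2\,\mathcal U(\mathbf U_{i_1}^i)\Big)\le0,$$ where $$\mathcal F_k^{*,i}=(\mathbf V_k^i)^T\hat{\mathbf F}_{i+1/2}-\psi_k^i,\qquad \mathcal F_0^{*,i}=(\mathbf V_0^i)^T\hat{\mathbf F}_{i-1/2}-\psi_0^i .$$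
   Context: **Equations.** 1D Euler equations with gravity $\mathbf U_t+\mathbf F(\mathbf U)_x=\mathbf S(\mathbf U,x)$ on $\Omega=[a,b]$, $\mathbf U=(\rho,m,\mathcal E)^T$, $m=\rho u$, $\mathbf F(\mathbf U)=(m,\rho u^2+p,u(\mathcal E+p))^T$, $\mathbf S(\mathbf U,x)=(0,-\rho\phi_x,-m\phi_x)^T$, with given time-independent potential $\phi(x)$ and $\mathcal E=\frac p{\gamma-1}+\frac12\rho u^2$, $\gamma=1.4$. Admissible set: $\mathscr G=\{(\rho,m,\mathcal E):\rho>0,\ p>0\}$. With $s=\ln(p\rho^{-\gamma})$, the entropy function is $\mathcal U=-\frac{\rho s}{\gamma-1}$, the entropy flux $\mathcal F=-\frac{\rho us}{\gamma-1}$, the entropy variable $\mathbf V=\mathcal U'(\mathbf U)^T=\big(\frac{\gamma-s}{\gamma-1}-\frac{\rho u^2}{2p},\ \frac{\rho u}{p},\ -\frac{\rho}{p}\big)^T$, and the potential flux $\psi=\rho u$; $\psi_{i_1}^i=\psi(\mathbf U_{i_1}^i)$. **Equilibrium.** $\mathbf U^e=(\rho^e,m^e,\mathcal E^e)^T:\Omega\to\mathscr G$ is a given (classical) steady state: $\mathbf F(\mathbf U^e)_x=\mathbf S(\mathbf U^e,x)$. **Discretization.** $\Omega$ is split into $N$ uniform cells $K_i=[x_{i-1/2},x_{i+1/2}]$ of length $\Delta x$ and center $x_i$. $-1=X_0<\dots<X_k=1$ ($k\ge1$) are the Gauss–Lobatto points on $[-1,1]$ with quadrature weights $\omega_0,\dots,\omega_k$;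 $L_l$ are the Lagrange basis polynomials at these points; $D_{jl}=L_l'(X_j)$; $\tau_0=-1$, $\tau_k=1$, $\tau_j=0$ otherwise. $x_i(X)=x_i+\frac{\Delta x}2X$. The unknown $\mathbf U_h$ is piecewise polynomial of degree $\le k$, determined by nodal values $\mathbf U_{i_1}^i=\mathbf U_h|_{K_i}(x_i(X_{i_1}))$; $\mathbf U_{i_1}^{e,i}=\mathbf U^e(x_i(X_{i_1}))$; $\mathbf F_{i_1}^i=\mathbf F(\mathbf U_{i_1}^i)$. $\mathbf F^S(\mathbf U_L,\mathbf U_R)$ is an entropy conservative flux: consistent ($\mathbf F^S(\mathbf U,\mathbf U)=\mathbf F(\mathbf U)$), symmetric, and $(\mathbf V_R-\mathbf V_L)^T\mathbf F^S(\mathbf U_L,\mathbf U_R)=\psi_R-\psi_L$. $\hat{\mathbf F}(\mathbf U_L,\mathbf U_R)=\frac12(\mathbf F(\mathbf U_L)+\mathbf F(\mathbf U_R))-\frac\alpha2(\mathbf U_R-\mathbf U_L)$ is the Lax–Friedrichs flux with $\alpha=\alpha(\mathbf U_L,\mathbf U_R)$ chosen large enough that $\hat{\mathbf F}$ is entropy stable, i.e. $(\mathbf V_R-\mathbf V_L)^T\hat{\mathbf F}(\mathbf U_L,\mathbf U_R)\le\psi_R-\psi_L$ for all $\mathbf U_L,\mathbf U_R\in\mathscr G$ (this property of $\hat{\mathbf F}$ is assumed). $\hat{\mathbf F}_{i+1/2}=\hat{\mathbf F}(\mathbf U_k^i,\mathbf U_0^{i+1})$; $\mathbf F_0^{*,i}=\hat{\mathbf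 F}_{i-1/2}$, $\mathbf F_k^{*,i}=\hat{\mathbf F}_{i+1/2}$, $\mathbf F_{i_1}^{*,i}=0$ for $0<i_1<k$. **Scheme.** For all $i,i_1$, $$\frac{\mathrm d\mathbf U_{i_1}^i}{\mathrm dt}+\frac2{\Delta x}\sum_{l=0}^k2D_{i_1,l}\mathbf F^S(\mathbf U_{i_1}^i,\mathbf U_l^i)+\frac2{\Delta x}\frac{\tau_{i_1}}{\omega_{i_1}}(\mathbf F_{i_1}^{*,i}-\mathbf F_{i_1}^i)=\mathbf S_{i_1}^i+\mathbf S_{i_1}^{0,i}-\mathbf S_{i_1}^{corr,i},$$ where, with $\phi_{x,i_1}^i=\phi_x(x_i(X_{i_1}))$, $\mathbf S_{i_1}^i=(0,-\rho_{i_1}^i\phi_{x,i_1}^i,-m_{i_1}^i\phi_{x,i_1}^i)^T$, $\mathbf S_{i_1}^{e,i}=(0,-\rho_{i_1}^{e,i}\phi_{x,i_1}^i,-m_{i_1}^{e,i}\phi_{x,i_1}^i)^T$, $$\mathbf S_{i_1}^{0,i}=\frac2{\Delta x}\sum_{l=0}^k2D_{i_1,l}\mathbf F^S(\mathbf U_{i_1}^{e,i},\mathbf U_l^{e,i})-\mathbf S_{i_1}^{e,i},\qquad \mathbf S_{i_1}^{corr,i}=\sigma_i(\mathbf V_{i_1}^i-\bar{\mathbf V}^i),$$ $$\sigma_i=\frac{\sum_{i_1=0}^k\omega_{i_1}(\mathbf V_{i_1}^i-\mathbf V_{i_1}^{e,i})^T\mathbf S_{i_1}^{0,i}}{\sum_{i_1=0}^k\omega_{i_1}\|\mathbf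 V_{i_1}^i-\bar{\mathbf V}^i\|^2},\quad \mathbf V_{i_1}^i=\mathbf V(\mathbf U_{i_1}^i),\ \mathbf V_{i_1}^{e,i}=\mathbf V(\mathbf U_{i_1}^{e,i}),\ \bar{\mathbf V}^i=\sum_{i_1=0}^k\frac{\omega_{i_1}}2\mathbf V_{i_1}^i;$$ if the denominator of $\sigma_i$ is zero, $\mathbf S_{i_1}^{corr,i}=\mathbf 0$. **Boundary conditions.** Periodic: $\mathbf U_k^0:=\mathbf U_k^N$, $\mathbf U_0^{N+1}:=\mathbf U_0^1$. Compactly supported: the boundary contributions at $x=a$ and $x=b$ vanish (here: $\mathcal F_0^{*,1}=\mathcal F_k^{*,N}=0$).
   Formalization: Both conclusions are proved at times when, in the cell (resp. in all cells), a zero denominator of σ_i implies a zero numerator; otherwise, with V constant on a cell and S^corr = 0, the claimed entropy balance is false. *)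

theory Defs
  imports "HOL-Analysis.Analysis" "HOL-Computational_Algebra.Polynomial"
begin

section \<open>Euler equations with gravity\<close>

text \<open>Conserved variables: components 1, 2, 3 are density, momentum and total energy.\<close>

type_synonym state = "real ^ 3"

definition adiabatic_index :: real ("\<gamma>") where
  "\<gamma> = 7 / 5"

definition velocity :: "state \<Rightarrow> real" where
  "velocity U = U $ 2 / U $ 1"

definition pressure :: "state \<Rightarrow> real" where
  "pressure U = (\<gamma> - 1) * (U $ 3 - U $ 1 * (velocity U)\<^sup>2 / 2)"

definition admissible :: "state set" where
  "admissible = {U. U $ 1 > 0 \<and> pressure U > 0}"

definition flux :: "state \<Rightarrow> state" where
  "flux U = vector [U $ 2,
                    U $ 1 * (velocity U)\<^sup>2 + pressure U,
                    velocity U * (U $ 3 + pressure U)]"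

text \<open>The second argument is the value of the potential gradient \<open>\<phi>\<^sub>x\<close>.\<close>

definition source :: "state \<Rightarrow> real \<Rightarrow> state" where
  "source U g = vector [0, - (U $ 1) * g, - (U $ 2) * g]"

definition specific_entropy :: "state \<Rightarrow> real" where
  "specific_entropy U = ln (pressure U * (U $ 1) powr (- \<gamma>))"

definition entropy :: "state \<Rightarrow> real" where
  "entropy U = - (U $ 1 * specific_entropy U) / (\<gamma> - 1)"

definition entropy_var :: "state \<Rightarrow> state" where
  "entropy_var U =
     vector [(\<gamma> - specific_entropy U) / (\<gamma> - 1) - U $ 1 * (velocity U)\<^sup>2 / (2 * pressure U),
             U $ 1 * velocity U / pressure U,
             - (U $ 1) / pressure U]"

definition potential_flux :: "state \<Rightarrow> real" where
  "potential_flux U = U $ 1 * velocity U"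

text \<open>Differentiability of the state itself is what makes the steady state classical:
  the flux of a stationary shock can be differentiable although the state is not.\<close>

definition steady_state :: "real \<Rightarrow> real \<Rightarrow> (real \<Rightarrow> real) \<Rightarrow> (real \<Rightarrow> state) \<Rightarrow> bool" where
  "steady_state a b \<phi>x Ue \<longleftrightarrow>
     (\<forall>x\<in>{a..b}. Ue x \<in> admissible \<and>
        Ue differentiable (at x within {a..b}) \<and>
        ((\<lambda>y. flux (Ue y)) has_vector_derivative source (Ue x) (\<phi>x x)) (at x within {a..b}))"

section \<open>Numerical fluxes\<close>

definition entropy_conservative_flux :: "(state \<Rightarrow> state \<Rightarrow> state) \<Rightarrow> bool" where
  "entropy_conservative_flux FS \<longleftrightarrow>
     (\<forall>U\<in>admissible. FS U U = flux U) \<and>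
     (\<forall>UL\<in>admissible. \<forall>UR\<in>admissible. FS UL UR = FS UR UL) \<and>
     (\<forall>UL\<in>admissible. \<forall>UR\<in>admissible.
        (entropy_var UR - entropy_var UL) \<bullet> FS UL UR = potential_flux UR - potential_flux UL)"

definition lax_friedrichs :: "(state \<Rightarrow> state \<Rightarrow> real) \<Rightarrow> state \<Rightarrow> state \<Rightarrow> state" where
  "lax_friedrichs \<alpha> UL UR =
     (1 / 2) *\<^sub>R (flux UL + flux UR) - (\<alpha> UL UR / 2) *\<^sub>R (UR - UL)"

definition entropy_stable_flux :: "(state \<Rightarrow> state \<Rightarrow> state) \<Rightarrow> bool" where
  "entropy_stable_flux Fh \<longleftrightarrow>
     (\<forall>UL\<in>admissible. \<forall>UR\<in>admissible.
        (entropy_var UR - entropy_var UL) \<bullet> Fh UL UR \<le> potential_flux UR - potential_flux UL)"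

section \<open>Gauss--Lobatto nodes and the mesh\<close>

text \<open>The \<open>(k+1)\<close>-point quadrature rule on \<open>[-1,1]\<close> that contains both endpoints and has
  the maximal degree of exactness \<open>2k - 1\<close>; this determines nodes and weights uniquely.\<close>

definition gauss_lobatto :: "nat \<Rightarrow> (nat \<Rightarrow> real) \<Rightarrow> (nat \<Rightarrow> real) \<Rightarrow> bool" where
  "gauss_lobatto k X \<omega> \<longleftrightarrow>
     X 0 = -1 \<and> X k = 1 \<and> strict_mono_on {..k} X \<and>
     (\<forall>p :: real poly. degree p \<le> 2 * k - 1 \<longrightarrow>
        (\<Sum>j\<le>k. \<omega> j * poly p (X j)) = integral {-1..1} (poly p))"

definition lagrange_basis :: "nat \<Rightarrow> (nat \<Rightarrow> real) \<Rightarrow> nat \<Rightarrow> real poly" where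
  "lagrange_basis k X l = (\<Prod>m\<in>{..k} - {l}. smult (1 / (X l - X m)) [:- X m, 1:])"

definition diff_matrix :: "nat \<Rightarrow> (nat \<Rightarrow> real) \<Rightarrow> nat \<Rightarrow> nat \<Rightarrow> real" where
  "diff_matrix k X j l = poly (pderiv (lagrange_basis k X l)) (X j)"

definition boundary_sign :: "nat \<Rightarrow> nat \<Rightarrow> real" where
  "boundary_sign k j = (if j = 0 then -1 else if j = k then 1 else 0)"

definition mesh_size :: "real \<Rightarrow> real \<Rightarrow> nat \<Rightarrow> real" where
  "mesh_size a b N = (b - a) / real N"

text \<open>Cells are numbered \<open>1, \<dots>, N\<close>; cell \<open>i\<close> has centre \<open>a + (i - 1/2) \<Delta>x\<close>.\<close>

definition node :: "real \<Rightarrow> real \<Rightarrow> nat \<Rightarrow> (nat \<Rightarrow> real) \<Rightarrow> nat \<Rightarrow> nat \<Rightarrow> real" where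
  "node a b N X i j =
     a + (real i - 1 / 2) * mesh_size a b N + mesh_size a b N / 2 * X j"

section \<open>The scheme on one cell\<close>

text \<open>In this section \<open>u\<close> and \<open>ue\<close> are the nodal values of the solution and of the equilibrium
  on one cell of length \<open>h\<close>, and \<open>g\<close> the nodal values of \<open>\<phi>\<^sub>x\<close>.\<close>

definition flux_difference ::
    "nat \<Rightarrow> (nat \<Rightarrow> real) \<Rightarrow> real \<Rightarrow> (state \<Rightarrow> state \<Rightarrow> state) \<Rightarrow> (nat \<Rightarrow> state) \<Rightarrow> nat \<Rightarrow> state" where
  "flux_difference k X h FS u j =
     (2 / h) *\<^sub>R (\<Sum>l\<le>k. (2 * diff_matrix k X j l) *\<^sub>R FS (u j) (u l))"

definition equilibrium_source ::
    "nat \<Rightarrow> (nat \<Rightarrow> real) \<Rightarrow> real \<Rightarrow> (state \<Rightarrow> state \<Rightarrow> state) \<Rightarrow> (nat \<Rightarrow> state) \<Rightarrow> (nat \<Rightarrow> real)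
       \<Rightarrow> nat \<Rightarrow> state" where
  "equilibrium_source k X h FS ue g j = flux_difference k X h FS ue j - source (ue j) (g j)"

definition mean_entropy_var :: "nat \<Rightarrow> (nat \<Rightarrow> real) \<Rightarrow> (nat \<Rightarrow> state) \<Rightarrow> state" where
  "mean_entropy_var k \<omega> u = (\<Sum>j\<le>k. (\<omega> j / 2) *\<^sub>R entropy_var (u j))"

definition sigma_num ::
    "nat \<Rightarrow> (nat \<Rightarrow> real) \<Rightarrow> (nat \<Rightarrow> state) \<Rightarrow> (nat \<Rightarrow> state) \<Rightarrow> (nat \<Rightarrow> state) \<Rightarrow> real" where
  "sigma_num k \<omega> u ue s0 =
     (\<Sum>j\<le>k. \<omega> j * ((entropy_var (u j) - entropy_var (ue j)) \<bullet> s0 j))"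

definition sigma_den :: "nat \<Rightarrow> (nat \<Rightarrow> real) \<Rightarrow> (nat \<Rightarrow> state) \<Rightarrow> real" where
  "sigma_den k \<omega> u =
     (\<Sum>j\<le>k. \<omega> j * (norm (entropy_var (u j) - mean_entropy_var k \<omega> u))\<^sup>2)"

definition correction_source ::
    "nat \<Rightarrow> (nat \<Rightarrow> real) \<Rightarrow> (nat \<Rightarrow> state) \<Rightarrow> (nat \<Rightarrow> state) \<Rightarrow> (nat \<Rightarrow> state) \<Rightarrow> nat \<Rightarrow> state" where
  "correction_source k \<omega> u ue s0 j =
     (if sigma_den k \<omega> u = 0 then 0
      else (sigma_num k \<omega> u ue s0 / sigma_den k \<omega> u)
             *\<^sub>R (entropy_var (u j) - mean_entropy_var k \<omega> u))"

section \<open>The semi-discrete scheme\<close>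

text \<open>\<open>U t i j\<close> is the value at time \<open>t\<close> in node \<open>j\<close> of cell \<open>i\<close>.  The exterior states at
  \<open>x = a\<close> and \<open>x = b\<close> are stored as \<open>U t 0 k\<close> and \<open>U t (N + 1) 0\<close>.\<close>

type_synonym nodal_values = "real \<Rightarrow> nat \<Rightarrow> nat \<Rightarrow> state"

text \<open>The flux at the interface between the cells \<open>i\<close> and \<open>i + 1\<close>, i.e. at \<open>x\<close> with index
  \<open>i + 1/2\<close>.\<close>

definition interface_flux ::
    "(state \<Rightarrow> state \<Rightarrow> real) \<Rightarrow> nat \<Rightarrow> nodal_values \<Rightarrow> real \<Rightarrow> nat \<Rightarrow> state" where
  "interface_flux \<alpha> k U t i = lax_friedrichs \<alpha> (U t i k) (U t (i + 1) 0)"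

definition nodal_numerical_flux ::
    "(state \<Rightarrow> state \<Rightarrow> real) \<Rightarrow> nat \<Rightarrow> nodal_values \<Rightarrow> real \<Rightarrow> nat \<Rightarrow> nat \<Rightarrow> state" where
  "nodal_numerical_flux \<alpha> k U t i j =
     (if j = 0 then interface_flux \<alpha> k U t (i - 1)
      else if j = k then interface_flux \<alpha> k U t i
      else 0)"

definition cell_equilibrium ::
    "real \<Rightarrow> real \<Rightarrow> nat \<Rightarrow> (nat \<Rightarrow> real) \<Rightarrow> (real \<Rightarrow> state) \<Rightarrow> nat \<Rightarrow> nat \<Rightarrow> state" where
  "cell_equilibrium a b N X Ue i j = Ue (node a b N X i j)"

definition cell_equilibrium_source ::
    "real \<Rightarrow> real \<Rightarrow> nat \<Rightarrow> nat \<Rightarrow> (nat \<Rightarrow> real) \<Rightarrow> (state \<Rightarrow> state \<Rightarrow> state) \<Rightarrow> (real \<Rightarrow> real)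
       \<Rightarrow> (real \<Rightarrow> state) \<Rightarrow> nat \<Rightarrow> nat \<Rightarrow> state" where
  "cell_equilibrium_source a b N k X FS \<phi>x Ue i =
     equilibrium_source k X (mesh_size a b N) FS (cell_equilibrium a b N X Ue i)
       (\<lambda>j. \<phi>x (node a b N X i j))"

definition semidiscrete_solution ::
    "real \<Rightarrow> real \<Rightarrow> nat \<Rightarrow> nat \<Rightarrow> (nat \<Rightarrow> real) \<Rightarrow> (nat \<Rightarrow> real) \<Rightarrow> (state \<Rightarrow> state \<Rightarrow> state)
       \<Rightarrow> (state \<Rightarrow> state \<Rightarrow> real) \<Rightarrow> (real \<Rightarrow> real) \<Rightarrow> (real \<Rightarrow> state)
       \<Rightarrow> real set \<Rightarrow> nodal_values \<Rightarrow> bool" where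
  "semidiscrete_solution a b N k X \<omega> FS \<alpha> \<phi>x Ue T U \<longleftrightarrow>
     (\<forall>t\<in>T. \<forall>i\<in>{1..N}. \<forall>j\<le>k.
        U t i j \<in> admissible \<and>
        (\<exists>U'. ((\<lambda>s. U s i j) has_vector_derivative U') (at t within T) \<and>
           U' + flux_difference k X (mesh_size a b N) FS (U t i) j
              + (2 / mesh_size a b N * (boundary_sign k j / \<omega> j))
                  *\<^sub>R (nodal_numerical_flux \<alpha> k U t i j - flux (U t i j))
           = source (U t i j) (\<phi>x (node a b N X i j))
              + cell_equilibrium_source a b N k X FS \<phi>x Ue i j
              - correction_source k \<omega> (U t i) (cell_equilibrium a b N X Ue i)
                  (cell_equilibrium_source a b N k X FS \<phi>x Ue i) j))"

text \<open>Excludes \<open>\<sigma>\<^sub>i\<close> being a quotient with zero denominator and nonzero numerator; trivially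
  true for a nonzero denominator.  In the excluded case the entropy variables are constant on
  the cell and the scheme applies no correction, although the quadrature error of the
  equilibrium source produces entropy, so the cell entropy balance fails.\<close>

definition correction_consistent ::
    "real \<Rightarrow> real \<Rightarrow> nat \<Rightarrow> nat \<Rightarrow> (nat \<Rightarrow> real) \<Rightarrow> (nat \<Rightarrow> real) \<Rightarrow> (state \<Rightarrow> state \<Rightarrow> state)
       \<Rightarrow> (real \<Rightarrow> real) \<Rightarrow> (real \<Rightarrow> state) \<Rightarrow> nodal_values \<Rightarrow> real \<Rightarrow> nat \<Rightarrow> bool" where
  "correction_consistent a b N k X \<omega> FS \<phi>x Ue U t i \<longleftrightarrow>
     (sigma_den k \<omega> (U t i) = 0 \<longrightarrow>
        sigma_num k \<omega> (U t i) (cell_equilibrium a b N X Ue i)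
          (cell_equilibrium_source a b N k X FS \<phi>x Ue i) = 0)"

definition cell_entropy ::
    "real \<Rightarrow> real \<Rightarrow> nat \<Rightarrow> nat \<Rightarrow> (nat \<Rightarrow> real) \<Rightarrow> nodal_values \<Rightarrow> real \<Rightarrow> nat \<Rightarrow> real" where
  "cell_entropy a b N k \<omega> U t i = (\<Sum>j\<le>k. \<omega> j * mesh_size a b N / 2 * entropy (U t i j))"

definition entropy_flux_right ::
    "(state \<Rightarrow> state \<Rightarrow> real) \<Rightarrow> nat \<Rightarrow> nodal_values \<Rightarrow> real \<Rightarrow> nat \<Rightarrow> real" where
  "entropy_flux_right \<alpha> k U t i =
     entropy_var (U t i k) \<bullet> interface_flux \<alpha> k U t i - potential_flux (U t i k)"

definition entropy_flux_left ::
    "(state \<Rightarrow> state \<Rightarrow> real) \<Rightarrow> nat \<Rightarrow> nodal_values \<Rightarrow> real \<Rightarrow> nat \<Rightarrow> real" where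
  "entropy_flux_left \<alpha> k U t i =
     entropy_var (U t i 0) \<bullet> interface_flux \<alpha> k U t (i - 1) - potential_flux (U t i 0)"

definition periodic_bc :: "nat \<Rightarrow> nat \<Rightarrow> real set \<Rightarrow> nodal_values \<Rightarrow> bool" where
  "periodic_bc N k T U \<longleftrightarrow> (\<forall>t\<in>T. U t 0 k = U t N k \<and> U t (N + 1) 0 = U t 1 0)"

definition compact_support_bc ::
    "(state \<Rightarrow> state \<Rightarrow> real) \<Rightarrow> nat \<Rightarrow> nat \<Rightarrow> real set \<Rightarrow> nodal_values \<Rightarrow> bool" where
  "compact_support_bc \<alpha> N k T U \<longleftrightarrow>
     (\<forall>t\<in>T. entropy_flux_left \<alpha> k U t 1 = 0 \<and> entropy_flux_right \<alpha> k U t N = 0)"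

end

theory Submission
  imports Defs
begin

text \<open>The Gauss--Lobatto rule is exact for the derivatives \<open>(L\<^sub>j L\<^sub>l)'\<close>, which gives summation
  by parts: \<open>Q\<^sub>j\<^sub>l = \<omega>\<^sub>j D\<^sub>j\<^sub>l\<close> satisfies \<open>Q + Q\<^sup>T = diag \<tau>\<close>.  Testing the flux difference with
  \<open>\<omega>\<^sub>j V\<^sub>j\<close> therefore leaves only the entropy fluxes \<open>V \<bullet> F - \<psi>\<close> at the two ends of the cell.  The
  gravity source is orthogonal to the entropy variables, and for a classical steady state
  \<open>(V \<bullet> F - \<psi>)\<^sub>x = V \<bullet> F\<^sub>x = V \<bullet> S = 0\<close>, so the equilibrium source produces no entropy when tested
  with the equilibrium entropy variables; the correction removes exactly the remaining part.
  Summing over the cells, the jump of the entropy flux at each interface has the sign given by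
  the entropy stability of the numerical flux.\<close>

section \<open>Summation by parts\<close>

lemma poly_lagrange_basis:
  assumes "inj_on X {..k}" "j \<le> k" "l \<le> k"
  shows "poly (lagrange_basis k X l) (X j) = (if j = l then 1 else 0)"
proof (cases "j = l")
  case True
  have "X l - X m \<noteq> 0" if "m \<in> {..k} - {l}" for m
    using that assms by (auto dest: inj_onD)
  then have "poly (lagrange_basis k X l) (X l) = (\<Prod>m\<in>{..k} - {l}. 1)"
    unfolding lagrange_basis_def poly_prod by (intro prod.cong) (auto simp del: smult_pCons)
  with True show ?thesis by simp
next
  case False
  then have "poly (lagrange_basis k X l) (X j) = 0"
    unfolding lagrange_basis_def poly_prod using assms by (intro prod_zero) auto
  with False show ?thesis by simp
qed

lemma degree_lagrange_basis:
  assumes "l \<le> k"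
  shows "degree (lagrange_basis k X l) \<le> k"
proof -
  have "degree (lagrange_basis k X l)
      \<le> (\<Sum>m\<in>{..k} - {l}. degree (smult (1 / (X l - X m)) [:- X m, 1:]))"
    unfolding lagrange_basis_def
    by (rule order_trans[OF degree_prod_sum_le]) (simp_all add: comp_def del: smult_pCons)
  also have "\<dots> \<le> (\<Sum>m\<in>{..k} - {l}. 1)"
    by (intro sum_mono order_trans[OF degree_smult_le]) simp
  also have "\<dots> = k"
    using assms by simp
  finally show ?thesis .
qed

text \<open>Both sides have degree at most \<open>k\<close> and agree at the \<open>k + 1\<close>
  distinct nodes.\<close>

lemma sum_lagrange_basis:
  assumes "inj_on X {..k}"
  shows "(\<Sum>l\<le>k. lagrange_basis k X l) = 1"
proof (rule poly_eqI_degree[where A = "X ` {..k}"])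
  show "poly (\<Sum>l\<le>k. lagrange_basis k X l) x = poly 1 x" if "x \<in> X ` {..k}" for x
    using that assms by (auto simp: poly_sum poly_lagrange_basis)
  have "degree (\<Sum>l\<le>k. lagrange_basis k X l) \<le> k"
    by (intro degree_sum_le degree_lagrange_basis) auto
  then show "degree (\<Sum>l\<le>k. lagrange_basis k X l) < card (X ` {..k})"
    using assms by (simp add: card_image)
  show "degree (1 :: real poly) < card (X ` {..k})"
    using assms by (simp add: card_image)
qed

text \<open>Obtained by differentiating the partition of unity: differentiation at the nodes
  annihilates constants.\<close>

lemma diff_matrix_row_sum:
  assumes "inj_on X {..k}"
  shows "(\<Sum>l\<le>k. diff_matrix k X j l) = 0"
proof -
  have "(\<Sum>l\<le>k. pderiv (lagrange_basis k X l)) = pderiv (\<Sum>l\<le>k. lagrange_basis k X l)"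
    using sum_comp_morphism[of pderiv "lagrange_basis k X"] by (simp add: pderiv_add comp_def)
  then have "(\<Sum>l\<le>k. diff_matrix k X j l) = poly (pderiv (\<Sum>l\<le>k. lagrange_basis k X l)) (X j)"
    unfolding diff_matrix_def by (simp only: poly_sum[symmetric])
  then show ?thesis
    using sum_lagrange_basis[OF assms] by simp
qed

section \<open>Consequences of the exactness of the Gauss-Lobatto rule\<close>

lemma integral_poly_pderiv:
  fixes p :: "real poly"
  assumes "c \<le> d"
  shows "integral {c..d} (poly (pderiv p)) = poly p d - poly p c"
proof -
  have "(poly (pderiv p) has_integral poly p d - poly p c) {c..d}"
    using assms
    by (intro fundamental_theorem_of_calculus)
      (auto intro: DERIV_subset poly_DERIV simp: has_real_derivative_iff_has_vector_derivative[symmetric])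
  then show ?thesis by (rule integral_unique)
qed

lemma gauss_lobatto_inj_on: "gauss_lobatto k X \<omega> \<Longrightarrow> inj_on X {..k}"
  by (auto simp: gauss_lobatto_def intro: strict_mono_on_imp_inj_on)

lemma gauss_lobatto_node_bounds:
  assumes "gauss_lobatto k X \<omega>" "j \<le> k"
  shows "-1 \<le> X j" "X j \<le> 1"
proof -
  have "mono_on {..k} X" "X 0 = -1" "X k = 1"
    using assms(1) by (auto simp: gauss_lobatto_def intro: strict_mono_on_imp_mono_on)
  then show "-1 \<le> X j" "X j \<le> 1"
    using assms(2) mono_onD[of "{..k}" X 0 j] mono_onD[of "{..k}" X j k] by auto
qed

lemma gauss_lobatto_sum_weights:
  assumes "gauss_lobatto k X \<omega>"
  shows "(\<Sum>j\<le>k. \<omega> j) = 2"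
proof -
  have "(\<Sum>j\<le>k. \<omega> j * poly 1 (X j)) = integral {-1..1} (poly 1)"
    using assms by (auto simp del: poly_1 simp: gauss_lobatto_def)
  moreover have "poly (1 :: real poly) = (\<lambda>_. 1)"
    by auto
  ultimately show ?thesis by simp
qed

lemma summation_by_parts:
  assumes gl: "gauss_lobatto k X \<omega>" and "k \<ge> 1" and j: "j \<le> k" and l: "l \<le> k"
  shows "\<omega> j * diff_matrix k X j l + \<omega> l * diff_matrix k X l j
       = (if j = l then boundary_sign k j else 0)"
proof -
  let ?L = "lagrange_basis k X"
  note L = poly_lagrange_basis[OF gauss_lobatto_inj_on[OF gl]]
  have X: "X 0 = -1" "X k = 1"
    using gl by (auto simp: gauss_lobatto_def)
  have "degree (?L j * ?L l) \<le> 2 * k"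
    using degree_mult_le[of "?L j" "?L l"] degree_lagrange_basis[OF j, of X]
      degree_lagrange_basis[OF l, of X] by linarith
  then have "degree (pderiv (?L j * ?L l)) \<le> 2 * k - 1"
    by (simp add: degree_pderiv)
  then have "(\<Sum>m\<le>k. \<omega> m * poly (pderiv (?L j * ?L l)) (X m))
      = integral {-1..1} (poly (pderiv (?L j * ?L l)))"
    using gl by (auto simp: gauss_lobatto_def)
  also have "\<dots> = poly (?L j * ?L l) (X k) - poly (?L j * ?L l) (X 0)"
    by (simp add: integral_poly_pderiv X)
  \<comment> \<open>A product of two basis polynomials is nonzero at an end node only if both belong
    to that node. Since \<open>k \<ge> 1\<close>, the two end nodes are different.\<close>
  also have "\<dots> = (if j = l then boundary_sign k j else 0)"
    using \<open>k \<ge> 1\<close> j l by (auto simp: L boundary_sign_def)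
  \<comment> \<open>In the product rule each term keeps one undifferentiated basis polynomial, so
    only the nodes \<open>m = j\<close> and \<open>m = l\<close> survive.\<close>
  also have "(\<Sum>m\<le>k. \<omega> m * poly (pderiv (?L j * ?L l)) (X m))
      = (\<Sum>m\<le>k. (if m = j then \<omega> j * diff_matrix k X j l else 0)
               + (if m = l then \<omega> l * diff_matrix k X l j else 0))"
    using j l by (intro sum.cong) (auto simp: L pderiv_mult diff_matrix_def algebra_simps)
  also have "\<dots> = \<omega> j * diff_matrix k X j l + \<omega> l * diff_matrix k X l j"
    using j l by (simp add: sum.distrib)
  finally show ?thesis .
qed

text \<open>The diagonal of the summation-by-parts identity, \<open>2 \<omega>\<^sub>j D\<^sub>j\<^sub>j = \<tau>\<^sub>j\<close>, shows that the boundary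
  weights do not vanish.\<close>

lemma boundary_sign_divide_weight:
  assumes "gauss_lobatto k X \<omega>" "k \<ge> 1" "j \<le> k"
  shows "\<omega> j * (boundary_sign k j / \<omega> j) = boundary_sign k j"
  \<comment> \<open>If \<open>\<omega> j = 0\<close>, the identity with \<open>l = j\<close> forces
    \<open>boundary_sign k j = 0\<close>, so the default value of division by zero does no
    harm.\<close>
  using summation_by_parts[OF assms assms(3)] by (cases "\<omega> j = 0") auto

lemma sum_boundary_sign:
  assumes "k \<ge> 1"
  shows "(\<Sum>j\<le>k. boundary_sign k j * f j) = f k - f 0"
proof -
  have "(\<Sum>j\<le>k. boundary_sign k j * f j)
      = (\<Sum>j\<le>k. (if j = k then f k else 0) - (if j = 0 then f 0 else 0))"
    using assms by (intro sum.cong) (auto simp: boundary_sign_def)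
  then show ?thesis by (simp add: sum_subtractf)
qed

text \<open>Split \<open>2 * Q\<close> into its symmetric part \<open>Q + Q^T\<close>, which lives
  on the diagonal and sees only the physical flux, and its antisymmetric part
  \<open>Q - Q^T\<close>, which sees only differences of the potential flux.\<close>

lemma flux_difference_entropy_production:
  assumes gl: "gauss_lobatto k X \<omega>" and k: "k \<ge> 1"
    and FS: "entropy_conservative_flux FS"
    and u: "\<And>j. j \<le> k \<Longrightarrow> u j \<in> admissible"
  shows "(\<Sum>j\<le>k. \<omega> j * (entropy_var (u j) \<bullet> flux_difference k X h FS u j))
       = 2 / h * ((entropy_var (u k) \<bullet> flux (u k) - potential_flux (u k))
                - (entropy_var (u 0) \<bullet> flux (u 0) - potential_flux (u 0)))"
proof -
  let ?V = "\<lambda>j. entropy_var (u j)" and ?\<psi> = "\<lambda>j. potential_flux (u j)"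
  let ?\<tau> = "boundary_sign k"
  define Q where "Q j l = \<omega> j * diff_matrix k X j l" for j l
  define G where "G j l = ?V j \<bullet> FS (u j) (u l)" for j l
  have sbp: "Q j l + Q l j = (if j = l then ?\<tau> j else 0)" if "j \<le> k" "l \<le> k" for j l
    unfolding Q_def by (rule summation_by_parts[OF gl k that])
  have row: "(\<Sum>l\<le>k. Q j l) = 0" for j
    unfolding Q_def using diff_matrix_row_sum[OF gauss_lobatto_inj_on[OF gl]]
    by (simp add: sum_distrib_left[symmetric])
  have diag: "(\<Sum>j\<le>k. \<Sum>l\<le>k. (Q j l + Q l j) * f j l) = (\<Sum>j\<le>k. ?\<tau> j * f j j)" for f
  proof (intro sum.cong refl)
    fix j assume j: "j \<in> {..k}"
    have "(\<Sum>l\<le>k. (Q j l + Q l j) * f j l) = (\<Sum>l\<le>k. if j = l then ?\<tau> j * f j j else 0)"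
      using j by (intro sum.cong) (auto simp: sbp)
    then show "(\<Sum>l\<le>k. (Q j l + Q l j) * f j l) = ?\<tau> j * f j j"
      using j by simp
  qed
  \<comment> \<open>Symmetry of \<open>FS\<close> lets both terms share one flux, so the difference
    is the entropy conservation condition.\<close>
  have jump: "G j l - G l j = ?\<psi> j - ?\<psi> l" if "j \<le> k" "l \<le> k" for j l
    using FS u[OF that(1)] u[OF that(2)]
    unfolding entropy_conservative_flux_def G_def by (metis inner_diff_left)
  have swap: "(\<Sum>j\<le>k. \<Sum>l\<le>k. Q l j * f j l) = (\<Sum>j\<le>k. \<Sum>l\<le>k. Q j l * f l j)" for f
    by (rule sum.swap)
  have Q\<psi>: "(\<Sum>j\<le>k. \<Sum>l\<le>k. Q j l * ?\<psi> j) = 0"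
    by (simp add: sum_distrib_right[symmetric] row)
  have "(\<Sum>j\<le>k. \<Sum>l\<le>k. 2 * Q j l * G j l)
      = (\<Sum>j\<le>k. \<Sum>l\<le>k. (Q j l + Q l j) * G j l)
        + ((\<Sum>j\<le>k. \<Sum>l\<le>k. Q j l * G j l) - (\<Sum>j\<le>k. \<Sum>l\<le>k. Q l j * G j l))"
    by (simp add: sum_subtractf[symmetric] sum.distrib[symmetric] algebra_simps)
  also have "(\<Sum>j\<le>k. \<Sum>l\<le>k. Q j l * G j l) - (\<Sum>j\<le>k. \<Sum>l\<le>k. Q l j * G j l)
      = (\<Sum>j\<le>k. \<Sum>l\<le>k. Q j l * (G j l - G l j))"
    unfolding swap by (simp add: sum_subtractf right_diff_distrib)
  also have "\<dots> = (\<Sum>j\<le>k. \<Sum>l\<le>k. Q j l * (?\<psi> j - ?\<psi> l))"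
    by (intro sum.cong) (auto simp: jump)
  also have "\<dots> = (\<Sum>j\<le>k. \<Sum>l\<le>k. Q j l * ?\<psi> j) - (\<Sum>j\<le>k. \<Sum>l\<le>k. Q l j * ?\<psi> j)"
    unfolding swap by (simp add: sum_subtractf right_diff_distrib)
  \<comment> \<open>Trading \<open>Q l j\<close> for \<open>(Q j l + Q l j) - Q j l\<close> leaves a
    sum that vanishes by the zero row sums and one that collapses to the diagonal.\<close>
  also have "\<dots> = 2 * (\<Sum>j\<le>k. \<Sum>l\<le>k. Q j l * ?\<psi> j) - (\<Sum>j\<le>k. \<Sum>l\<le>k. (Q j l + Q l j) * ?\<psi> j)"
    by (simp add: sum.distrib distrib_right)
  also have "\<dots> = - (\<Sum>j\<le>k. ?\<tau> j * ?\<psi> j)"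
    unfolding Q\<psi> diag by simp
  finally have "(\<Sum>j\<le>k. \<Sum>l\<le>k. 2 * Q j l * G j l) = (\<Sum>j\<le>k. ?\<tau> j * (G j j - ?\<psi> j))"
    unfolding diag by (simp add: sum_subtractf right_diff_distrib)
  also have "\<dots> = (G k k - ?\<psi> k) - (G 0 0 - ?\<psi> 0)"
    by (rule sum_boundary_sign[OF k])
  also have "\<dots> = (?V k \<bullet> flux (u k) - ?\<psi> k) - (?V 0 \<bullet> flux (u 0) - ?\<psi> 0)"
    using FS u[of k] u[of 0] by (simp add: G_def entropy_conservative_flux_def)
  finally have *: "(\<Sum>j\<le>k. \<Sum>l\<le>k. 2 * Q j l * G j l)
      = (?V k \<bullet> flux (u k) - ?\<psi> k) - (?V 0 \<bullet> flux (u 0) - ?\<psi> 0)" .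
  have "(\<Sum>j\<le>k. \<omega> j * (?V j \<bullet> flux_difference k X h FS u j))
      = 2 / h * (\<Sum>j\<le>k. \<Sum>l\<le>k. 2 * Q j l * G j l)"
    by (simp add: flux_difference_def inner_sum_right sum_distrib_left Q_def G_def algebra_simps)
  then show ?thesis
    unfolding * .
qed

section \<open>Entropy pair of the Euler equations\<close>

lemma admissibleD:
  assumes "U \<in> admissible"
  shows "U $ 1 > 0" "pressure U > 0"
  using assms by (auto simp: admissible_def)

text \<open>The momentum and energy contributions cancel because density times velocity is the
  momentum, which requires a nonzero density.\<close>

lemma entropy_var_source:
  assumes "U $ 1 \<noteq> 0"
  shows "entropy_var U \<bullet> source U g = 0"
  using assms by (simp add: entropy_var_def source_def inner_vec_def sum_3 velocity_def)

text \<open>The right-hand side is the entropy flux of the Euler equations; this closed form is the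
  one differentiated along the steady state.\<close>

lemma entropy_var_flux:
  assumes "U \<in> admissible"
  shows "entropy_var U \<bullet> flux U - potential_flux U = - (U $ 2 * specific_entropy U) / (\<gamma> - 1)"
proof -
  define r v p s where defs: "r = U $ 1" "v = velocity U" "p = pressure U" "s = specific_entropy U"
  have pos: "r > 0" "p > 0"
    using admissibleD[OF assms] by (auto simp: defs)
  have m: "U $ 2 = r * v"
    using pos by (simp add: defs velocity_def)
  \<comment> \<open>The constant \<open>5 / 2\<close> is \<open>1 / (\<gamma> - 1)\<close>.\<close>
  have E: "U $ 3 = 5 / 2 * p + r * v\<^sup>2 / 2"
    by (simp add: defs pressure_def adiabatic_index_def field_simps)
  show ?thesis
    using pos
    by (simp add: entropy_var_def flux_def potential_flux_def inner_vec_def sum_3 E m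
        defs[symmetric] adiabatic_index_def divide_simps) (simp add: power2_eq_square algebra_simps)
qed

section \<open>Chain rules along curves of states\<close>

lemma has_real_derivative_vec_nth:
  fixes f :: "real \<Rightarrow> real ^ 'n"
  assumes "(f has_vector_derivative f') F"
  shows "((\<lambda>x. f x $ i) has_real_derivative f' $ i) F"
  unfolding has_real_derivative_iff_has_vector_derivative
  using bounded_linear.has_vector_derivative[OF bounded_linear_vec_nth assms] .

lemma velocity_has_derivative:
  assumes U: "(U has_vector_derivative U') (at x within S)" and "U x $ 1 \<noteq> 0"
  shows "((\<lambda>y. velocity (U y)) has_real_derivative
           (U' $ 2 - velocity (U x) * U' $ 1) / (U x $ 1)) (at x within S)"
  unfolding velocity_def
  by (rule derivative_eq_intros has_real_derivative_vec_nth[OF U] refl assms(2))+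
    (use assms(2) in \<open>simp add: field_simps\<close>)

lemma pressure_has_derivative:
  assumes U: "(U has_vector_derivative U') (at x within S)" and "U x $ 1 \<noteq> 0"
  shows "((\<lambda>y. pressure (U y)) has_real_derivative
           (\<gamma> - 1) * (U' $ 3 - velocity (U x) * U' $ 2 + (velocity (U x))\<^sup>2 / 2 * U' $ 1))
         (at x within S)"
proof -
  note v = velocity_has_derivative[OF assms]
  note D = has_real_derivative_vec_nth[OF U]
  show ?thesis
    unfolding pressure_def power2_eq_square
    by (rule DERIV_cong[OF DERIV_cmult[OF DERIV_diff[OF D DERIV_cdivide[OF DERIV_mult[OF D
        DERIV_mult[OF v v]]]]]])
      (use assms(2) in \<open>simp add: field_simps\<close>)
qed

text \<open>The pressure derivative stays a parameter, so that it can be supplied either in expanded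
  form or as an abbreviation.\<close>

lemma specific_entropy_has_derivative:
  assumes U: "(U has_vector_derivative U') (at x within S)" and adm: "U x \<in> admissible"
    and p: "((\<lambda>y. pressure (U y)) has_real_derivative p') (at x within S)"
  shows "((\<lambda>y. specific_entropy (U y)) has_real_derivative
           p' / pressure (U x) - \<gamma> * U' $ 1 / U x $ 1) (at x within S)"
proof -
  note pos = admissibleD[OF adm]
  have "((\<lambda>y. U y $ 1 powr - \<gamma>) has_real_derivative
      - \<gamma> * U x $ 1 powr (- \<gamma> - 1) * U' $ 1) (at x within S)"
    using DERIV_chain2[OF has_real_derivative_powr[OF pos(1)] has_real_derivative_vec_nth[OF U]] .
  note D = DERIV_mult[OF p this]
  have pp: "pressure (U x) * U x $ 1 powr - \<gamma> > 0"
    using pos by simp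
  show ?thesis
    unfolding specific_entropy_def
    by (rule DERIV_cong[OF DERIV_chain2[OF DERIV_ln_divide[OF pp] D]])
      (use pos in \<open>simp add: powr_diff field_simps\<close>)
qed

text \<open>This expresses that the entropy variable is the gradient of the entropy. The version
  along a curve is what the nodal trajectories need.\<close>

lemma entropy_has_derivative:
  assumes U: "(U has_vector_derivative U') (at x within S)" and adm: "U x \<in> admissible"
  shows "((\<lambda>y. entropy (U y)) has_real_derivative entropy_var (U x) \<bullet> U') (at x within S)"
proof -
  note pos = admissibleD[OF adm]
  define v p where defs: "v = velocity (U x)" "p = pressure (U x)"
  have nz: "U x $ 1 \<noteq> 0" "p \<noteq> 0"
    using pos by (auto simp: defs)
  note s = specific_entropy_has_derivative[OF U adm pressure_has_derivative[OF U nz(1)]]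
  have "((\<lambda>y. - (U y $ 1 * specific_entropy (U y)) / (\<gamma> - 1)) has_real_derivative
      - (U' $ 1 * specific_entropy (U x)
         + ((\<gamma> - 1) * (U' $ 3 - v * U' $ 2 + v\<^sup>2 / 2 * U' $ 1) / p - \<gamma> * U' $ 1 / U x $ 1)
           * U x $ 1) / (\<gamma> - 1)) (at x within S)"
    unfolding defs
    by (intro DERIV_cdivide DERIV_minus DERIV_mult has_real_derivative_vec_nth[OF U] s)
  then show ?thesis
    unfolding entropy_def
    by (rule DERIV_cong)
      (use nz in \<open>simp add: entropy_var_def inner_vec_def sum_3 defs[symmetric] adiabatic_index_def
        field_simps power2_eq_square\<close>)
qed

text \<open>The identity \<open>(V \<bullet> F - \<psi>)' = V \<bullet> F'\<close> in primitive variables: density \<open>r\<close>, velocity \<open>v\<close>,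
  pressure \<open>p\<close>, energy \<open>5/2 p + r v\<^sup>2/2\<close>, with \<open>\<gamma> = 7/5\<close>.\<close>

lemma entropy_flux_chain_rule:
  fixes r v p s r' v' p' :: real
  assumes "r \<noteq> 0" "p \<noteq> 0"
  shows "- ((v' * r + v * r') * s + (p' / p - 7 / 5 * r' / r) * (r * v)) / (7 / 5 - 1)
    = ((7 / 5 - s) / (7 / 5 - 1) - r * v\<^sup>2 / (2 * p)) * (v' * r + v * r')
      + r * v / p * (r' * v\<^sup>2 + 2 * v * v' * r + p')
      + - r / p * (v' * (5 / 2 * p + r * v\<^sup>2 / 2 + p)
          + (5 / 2 * p' + v * (v' * r + v * r') - v\<^sup>2 / 2 * r' + p') * v)"
  using assms by (simp add: field_simps power2_eq_square)

text \<open>The flux derivative \<open>F'\<close> is a separate datum so that the gravity source can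
  be inserted for it. Uniqueness of derivatives identifies it with the expression computed from
  \<open>U'\<close>; \<open>nontriv\<close> provides this uniqueness.\<close>

lemma entropy_flux_has_derivative:
  assumes U: "(U has_vector_derivative U') (at x within S)"
    and F: "((\<lambda>y. flux (U y)) has_vector_derivative F') (at x within S)"
    and nontriv: "at x within S \<noteq> bot" and adm: "U x \<in> admissible"
  shows "((\<lambda>y. - (U y $ 2 * specific_entropy (U y)) / (\<gamma> - 1)) has_real_derivative
           entropy_var (U x) \<bullet> F') (at x within S)"
proof -
  note pos = admissibleD[OF adm]
  define r v p s where defs: "r = U x $ 1" "v = velocity (U x)" "p = pressure (U x)"
    "s = specific_entropy (U x)"
  have nz: "r \<noteq> 0" "U x $ 1 \<noteq> 0" "p \<noteq> 0"
    using pos by (auto simp: defs)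
  note uniq = has_field_derivative_unique[OF _ _ nontriv]
  note U1 = has_real_derivative_vec_nth[OF U, where i = 1]
  note U2 = has_real_derivative_vec_nth[OF U, where i = 2]
  note U3 = has_real_derivative_vec_nth[OF U, where i = 3]
  define v' where "v' = (U' $ 2 - v * U' $ 1) / r"
  define p' where "p' = (\<gamma> - 1) * (U' $ 3 - v * U' $ 2 + v\<^sup>2 / 2 * U' $ 1)"
  have Dv: "((\<lambda>y. velocity (U y)) has_real_derivative v') (at x within S)"
    unfolding v'_def defs by (rule velocity_has_derivative[OF U nz(2)])
  have Dp: "((\<lambda>y. pressure (U y)) has_real_derivative p') (at x within S)"
    unfolding p'_def defs by (rule pressure_has_derivative[OF U nz(2)])
  note Ds = specific_entropy_has_derivative[OF U adm Dp, folded defs]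
  have F1: "F' $ 1 = U' $ 2"
    using has_real_derivative_vec_nth[OF F, where i = 1]
    by (intro uniq[OF _ U2]) (simp add: flux_def)
  have F2: "F' $ 2 = U' $ 1 * v\<^sup>2 + 2 * v * v' * r + p'"
  proof (rule uniq)
    show "((\<lambda>y. U y $ 1 * (velocity (U y))\<^sup>2 + pressure (U y)) has_real_derivative F' $ 2)
        (at x within S)"
      using has_real_derivative_vec_nth[OF F, where i = 2] by (simp add: flux_def)
    show "((\<lambda>y. U y $ 1 * (velocity (U y))\<^sup>2 + pressure (U y)) has_real_derivative
        U' $ 1 * v\<^sup>2 + 2 * v * v' * r + p') (at x within S)"
      by (rule derivative_eq_intros U1 Dv Dp refl)+ (simp add: defs)
  qed
  have F3: "F' $ 3 = v' * (U x $ 3 + p) + (U' $ 3 + p') * v"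
  proof (rule uniq)
    show "((\<lambda>y. velocity (U y) * (U y $ 3 + pressure (U y))) has_real_derivative F' $ 3)
        (at x within S)"
      using has_real_derivative_vec_nth[OF F, where i = 3] by (simp add: flux_def)
    show "((\<lambda>y. velocity (U y) * (U y $ 3 + pressure (U y))) has_real_derivative
        v' * (U x $ 3 + p) + (U' $ 3 + p') * v) (at x within S)"
      unfolding defs by (intro DERIV_mult DERIV_add U3 Dv Dp)
  qed
  have V: "entropy_var (U x) \<bullet> F' = ((\<gamma> - s) / (\<gamma> - 1) - r * v\<^sup>2 / (2 * p)) * F' $ 1
      + r * v / p * F' $ 2 + - r / p * F' $ 3"
    by (simp add: entropy_var_def inner_vec_def sum_3 defs)
  have m: "U x $ 2 = r * v"
    using nz by (simp add: defs velocity_def)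
  have E: "U x $ 3 = 5 / 2 * p + r * v\<^sup>2 / 2"
    by (simp add: defs pressure_def adiabatic_index_def field_simps)
  \<comment> \<open>Solving the definitions of \<open>v'\<close> and \<open>p'\<close> for the
    momentum and energy derivatives reduces the claim to the identity in primitive variables, with
    \<open>U' $ 1\<close> as density derivative.\<close>
  have m': "U' $ 2 = v' * r + v * U' $ 1"
    using nz by (simp add: v'_def)
  have E': "U' $ 3 = 5 / 2 * p' + v * U' $ 2 - v\<^sup>2 / 2 * U' $ 1"
    by (simp add: p'_def adiabatic_index_def field_simps)
  have "((\<lambda>y. - (U y $ 2 * specific_entropy (U y)) / (\<gamma> - 1)) has_real_derivative
      - (U' $ 2 * s + (p' / p - \<gamma> * U' $ 1 / r) * U x $ 2) / (\<gamma> - 1)) (at x within S)"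
    unfolding defs(4) by (intro DERIV_cdivide DERIV_minus DERIV_mult U2 Ds)
  then show ?thesis
    by (rule DERIV_cong)
      (simp only: V F1 F2 F3 E m E' m' entropy_flux_chain_rule[OF nz(1,3)] adiabatic_index_def)
qed

lemma steady_state_entropy_flux_constant:
  assumes "a < b" and st: "steady_state a b \<phi>x Ue" and x: "x \<in> {a..b}" and y: "y \<in> {a..b}"
  shows "entropy_var (Ue x) \<bullet> flux (Ue x) - potential_flux (Ue x)
       = entropy_var (Ue y) \<bullet> flux (Ue y) - potential_flux (Ue y)"
proof -
  let ?f = "\<lambda>z. - (Ue z $ 2 * specific_entropy (Ue z)) / (\<gamma> - 1)"
  have adm: "Ue z \<in> admissible" if "z \<in> {a..b}" for z
    using st that by (auto simp: steady_state_def)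
  have "(?f has_real_derivative 0) (at z within {a..b})" if z: "z \<in> {a..b}" for z
  proof -
    have "(Ue has_vector_derivative vector_derivative Ue (at z within {a..b})) (at z within {a..b})"
      and F: "((\<lambda>y. flux (Ue y)) has_vector_derivative source (Ue z) (\<phi>x z)) (at z within {a..b})"
      using st z by (auto simp: steady_state_def vector_derivative_works[symmetric])
    \<comment> \<open>As \<open>a < b\<close>, every point, including the two ends, is a limit point
      of the interval.\<close>
    moreover have "at z within {a..b} \<noteq> bot"
      using \<open>a < b\<close> z by (auto simp: trivial_limit_within islimpt_Icc)
    ultimately have "(?f has_real_derivative entropy_var (Ue z) \<bullet> source (Ue z) (\<phi>x z))
        (at z within {a..b})"
      by (intro entropy_flux_has_derivative adm z)
    then show ?thesis
      using admissibleD(1)[OF adm[OF z]] by (simp add: entropy_var_source)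
  qed
  then obtain c where c: "\<And>z. z \<in> {a..b} \<Longrightarrow> ?f z = c"
    using has_field_derivative_zero_constant[of "{a..b}" ?f] by blast
  show ?thesis
    unfolding entropy_var_flux[OF adm[OF x]] entropy_var_flux[OF adm[OF y]] c[OF x] c[OF y]
    by (rule refl)
qed

section \<open>Entropy balance of the scheme\<close>

lemma node_in_domain:
  assumes "a < b" "i \<in> {1..N}" and X: "-1 \<le> X j" "X j \<le> 1"
  shows "node a b N X i j \<in> {a..b}"
proof -
  define h where "h = mesh_size a b N"
  have h: "h > 0" "a + real N * h = b"
    using assms by (auto simp: h_def mesh_size_def)
  \<comment> \<open>The factor of \<open>h\<close> lies between \<open>i - 1\<close> and
    \<open>i\<close>, hence between \<open>0\<close> and \<open>N\<close>.\<close>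
  have eq: "node a b N X i j = a + (real i - 1 / 2 + X j / 2) * h"
    by (simp add: node_def h_def algebra_simps)
  have "0 \<le> (real i - 1 / 2 + X j / 2) * h"
    using assms h by (intro mult_nonneg_nonneg) auto
  moreover have "(real i - 1 / 2 + X j / 2) * h \<le> real N * h"
    using assms h by (intro mult_right_mono) auto
  ultimately show ?thesis
    using h(2) eq by auto
qed

text \<open>The weighted deviations from the mean sum to zero because the weights sum to 2. Testing
  with \<open>V\<close> thus equals testing with \<open>V\<close> minus its mean, which yields
  \<open>sigma_den\<close> and cancels the denominator of the quotient. For a zero denominator,
  \<open>consistent\<close> makes the numerator vanish too.\<close>

lemma correction_entropy_production:
  assumes w: "(\<Sum>j\<le>k. \<omega> j) = 2"
    and consistent: "sigma_den k \<omega> u = 0 \<Longrightarrow> sigma_num k \<omega> u ue s0 = 0"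
  shows "(\<Sum>j\<le>k. \<omega> j * (entropy_var (u j) \<bullet> correction_source k \<omega> u ue s0 j))
       = sigma_num k \<omega> u ue s0"
proof (cases "sigma_den k \<omega> u = 0")
  case True
  then show ?thesis
    using consistent by (simp add: correction_source_def)
next
  case False
  let ?V = "\<lambda>j. entropy_var (u j)" and ?M = "mean_entropy_var k \<omega> u"
  have "(\<Sum>j\<le>k. \<omega> j *\<^sub>R ?V j) = 2 *\<^sub>R ?M"
    by (simp add: mean_entropy_var_def scaleR_sum_right)
  then have mean: "(\<Sum>j\<le>k. \<omega> j *\<^sub>R (?V j - ?M)) = 0"
    using w by (simp add: scaleR_diff_right sum_subtractf scaleR_left.sum[symmetric])
  have "(\<Sum>j\<le>k. \<omega> j * (?V j \<bullet> (?V j - ?M)))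
      = (\<Sum>j\<le>k. \<omega> j * ((?V j - ?M) \<bullet> (?V j - ?M)) + ?M \<bullet> (\<omega> j *\<^sub>R (?V j - ?M)))"
    by (intro sum.cong) (auto simp: inner_diff_left algebra_simps)
  also have "\<dots> = sigma_den k \<omega> u + ?M \<bullet> (\<Sum>j\<le>k. \<omega> j *\<^sub>R (?V j - ?M))"
    by (simp only: sum.distrib inner_sum_right sigma_den_def power2_norm_eq_inner)
  finally have *: "(\<Sum>j\<le>k. \<omega> j * (?V j \<bullet> (?V j - ?M))) = sigma_den k \<omega> u"
    unfolding mean by simp
  have "(\<Sum>j\<le>k. \<omega> j * (?V j \<bullet> correction_source k \<omega> u ue s0 j))
      = (sigma_num k \<omega> u ue s0 / sigma_den k \<omega> u) * (\<Sum>j\<le>k. \<omega> j * (?V j \<bullet> (?V j - ?M)))"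
    using False unfolding sum_distrib_left
    by (intro sum.cong) (auto simp: correction_source_def)
  then show ?thesis
    unfolding * using False by simp
qed

text \<open>The gravity term drops out, and the flux difference leaves the entropy fluxes at the two
  cell ends, which agree along a steady state.\<close>

lemma equilibrium_source_entropy_production:
  assumes "a < b" "i \<in> {1..N}" "k \<ge> 1" and gl: "gauss_lobatto k X \<omega>"
    and st: "steady_state a b \<phi>x Ue" and FS: "entropy_conservative_flux FS"
  shows "(\<Sum>j\<le>k. \<omega> j * (entropy_var (cell_equilibrium a b N X Ue i j)
            \<bullet> cell_equilibrium_source a b N k X FS \<phi>x Ue i j)) = 0"
proof -
  let ?ue = "cell_equilibrium a b N X Ue i" and ?h = "mesh_size a b N"
  let ?g = "\<lambda>j. \<phi>x (node a b N X i j)"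
  have node: "node a b N X i j \<in> {a..b}" if "j \<le> k" for j
    using node_in_domain[OF assms(1,2)] gauss_lobatto_node_bounds[OF gl that] by blast
  have adm: "?ue j \<in> admissible" if "j \<le> k" for j
    using st node[OF that] by (auto simp: steady_state_def cell_equilibrium_def)
  have src: "entropy_var (?ue j) \<bullet> source (?ue j) (?g j) = 0" if "j \<le> k" for j
    using admissibleD(1)[OF adm[OF that]] by (intro entropy_var_source) simp
  have "(\<Sum>j\<le>k. \<omega> j * (entropy_var (?ue j) \<bullet> cell_equilibrium_source a b N k X FS \<phi>x Ue i j))
      = (\<Sum>j\<le>k. \<omega> j * (entropy_var (?ue j) \<bullet> flux_difference k X ?h FS ?ue j))"
    by (intro sum.cong)
      (auto simp: cell_equilibrium_source_def equilibrium_source_def inner_diff_right src)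
  also have "\<dots> = 2 / ?h *
      ((entropy_var (?ue k) \<bullet> flux (?ue k) - potential_flux (?ue k))
       - (entropy_var (?ue 0) \<bullet> flux (?ue 0) - potential_flux (?ue 0)))"
    by (rule flux_difference_entropy_production[OF gl \<open>k \<ge> 1\<close> FS adm])
  also have "\<dots> = 0"
    using steady_state_entropy_flux_constant[OF assms(1) st node[of k] node[of 0]]
    by (simp add: cell_equilibrium_def)
  finally show ?thesis .
qed

lemma cell_entropy_has_derivative:
  assumes "a < b" and i: "i \<in> {1..N}" and k: "k \<ge> 1" and gl: "gauss_lobatto k X \<omega>"
    and st: "steady_state a b \<phi>x Ue" and FS: "entropy_conservative_flux FS"
    and sol: "semidiscrete_solution a b N k X \<omega> FS \<alpha> \<phi>x Ue T U" and t: "t \<in> T"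
    and cc: "correction_consistent a b N k X \<omega> FS \<phi>x Ue U t i"
  shows "((\<lambda>s. cell_entropy a b N k \<omega> U s i) has_real_derivative
           - (entropy_flux_right \<alpha> k U t i - entropy_flux_left \<alpha> k U t i)) (at t within T)"
proof -
  let ?h = "mesh_size a b N" and ?u = "U t i" and ?ue = "cell_equilibrium a b N X Ue i"
  let ?V = "\<lambda>j. entropy_var (U t i j)" and ?\<psi> = "\<lambda>j. potential_flux (U t i j)"
  let ?FD = "flux_difference k X ?h FS ?u"
  let ?F = "nodal_numerical_flux \<alpha> k U t i"
  let ?s0 = "cell_equilibrium_source a b N k X FS \<phi>x Ue i"
  let ?c = "correction_source k \<omega> ?u ?ue ?s0"
  let ?S = "\<lambda>j. source (U t i j) (\<phi>x (node a b N X i j))"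
  let ?\<tau> = "boundary_sign k"
  have h: "?h > 0"
    using assms(1) i by (simp add: mesh_size_def)
  have adm: "?u j \<in> admissible" if "j \<le> k" for j
    using sol t i that by (auto simp: semidiscrete_solution_def)
  have "\<forall>j. \<exists>D. j \<le> k \<longrightarrow> ((\<lambda>s. U s i j) has_vector_derivative D) (at t within T) \<and>
      D + ?FD j + (2 / ?h * (?\<tau> j / \<omega> j)) *\<^sub>R (?F j - flux (?u j)) = ?S j + ?s0 j - ?c j"
    using sol t i unfolding semidiscrete_solution_def by blast
  then obtain D where D: "\<And>j. j \<le> k \<Longrightarrow> ((\<lambda>s. U s i j) has_vector_derivative D j) (at t within T)"
    and eq: "\<And>j. j \<le> k \<Longrightarrow>
      D j + ?FD j + (2 / ?h * (?\<tau> j / \<omega> j)) *\<^sub>R (?F j - flux (?u j)) = ?S j + ?s0 j - ?c j"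
    by metis
  \<comment> \<open>The scheme is tested with \<open>\<omega> j\<close> times the entropy variable:
    gravity disappears, and the weight cancels the one dividing the boundary sign.\<close>
  have balance: "\<omega> j * (?V j \<bullet> D j)
      = \<omega> j * (?V j \<bullet> ?s0 j) - \<omega> j * (?V j \<bullet> ?c j) - \<omega> j * (?V j \<bullet> ?FD j)
        - 2 / ?h * (?\<tau> j * (?V j \<bullet> (?F j - flux (?u j))))" if j: "j \<le> k" for j
  proof -
    have S0: "?V j \<bullet> ?S j = 0"
      using admissibleD(1)[OF adm[OF j]] by (intro entropy_var_source) simp
    have "D j = ?S j + ?s0 j - ?c j - ?FD j
        - (2 / ?h * (?\<tau> j / \<omega> j)) *\<^sub>R (?F j - flux (?u j))"
      using eq[OF j] by (simp add: algebra_simps)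
    then have "\<omega> j * (?V j \<bullet> D j)
        = \<omega> j * (?V j \<bullet> ?s0 j) - \<omega> j * (?V j \<bullet> ?c j) - \<omega> j * (?V j \<bullet> ?FD j)
          - 2 / ?h * ((\<omega> j * (?\<tau> j / \<omega> j)) * (?V j \<bullet> (?F j - flux (?u j))))"
      by (simp only: inner_diff_right inner_add_right inner_scaleR_right S0) (simp add: algebra_simps)
    then show ?thesis
      unfolding boundary_sign_divide_weight[OF gl k j] .
  qed
  \<comment> \<open>Write \<open>V = (V - V^e) + V^e\<close>: the first part is the numerator of
    sigma, and the second produces no entropy.\<close>
  have "(\<Sum>j\<le>k. \<omega> j * (?V j \<bullet> ?s0 j))
      = sigma_num k \<omega> ?u ?ue ?s0 + (\<Sum>j\<le>k. \<omega> j * (entropy_var (?ue j) \<bullet> ?s0 j))"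
    by (simp add: sigma_num_def sum.distrib[symmetric] inner_diff_left algebra_simps)
  also have "\<dots> = (\<Sum>j\<le>k. \<omega> j * (?V j \<bullet> ?c j))"
    using cc equilibrium_source_entropy_production[OF assms(1) i k gl st FS]
      correction_entropy_production[OF gauss_lobatto_sum_weights[OF gl], of ?u ?ue ?s0]
    by (simp add: correction_consistent_def)
  finally have src: "(\<Sum>j\<le>k. \<omega> j * (?V j \<bullet> ?s0 j)) = (\<Sum>j\<le>k. \<omega> j * (?V j \<bullet> ?c j))" .
  have FD: "(\<Sum>j\<le>k. \<omega> j * (?V j \<bullet> ?FD j))
      = 2 / ?h * ((?V k \<bullet> flux (?u k) - ?\<psi> k) - (?V 0 \<bullet> flux (?u 0) - ?\<psi> 0))"
    by (rule flux_difference_entropy_production[OF gl k FS adm])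
  have "(\<Sum>j\<le>k. \<omega> j * (?V j \<bullet> D j))
      = - (\<Sum>j\<le>k. \<omega> j * (?V j \<bullet> ?FD j))
        - 2 / ?h * (\<Sum>j\<le>k. ?\<tau> j * (?V j \<bullet> (?F j - flux (?u j))))"
    using src by (simp add: balance sum_subtractf sum_distrib_left)
  \<comment> \<open>The physical fluxes at the cell ends cancel between the volume and boundary
    terms, leaving the numerical ones.\<close>
  also have "\<dots> = - (2 / ?h) * ((?V k \<bullet> ?F k - ?\<psi> k) - (?V 0 \<bullet> ?F 0 - ?\<psi> 0))"
    unfolding sum_boundary_sign[OF k] FD by (simp add: inner_diff_right algebra_simps)
  also have "\<dots> = - (2 / ?h) * (entropy_flux_right \<alpha> k U t i - entropy_flux_left \<alpha> k U t i)"
    using k by (simp add: nodal_numerical_flux_def entropy_flux_right_def entropy_flux_left_def)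
  finally have total: "(\<Sum>j\<le>k. \<omega> j * (?V j \<bullet> D j))
      = - (2 / ?h) * (entropy_flux_right \<alpha> k U t i - entropy_flux_left \<alpha> k U t i)" .
  have "((\<lambda>s. cell_entropy a b N k \<omega> U s i) has_real_derivative
      (\<Sum>j\<le>k. \<omega> j * ?h / 2 * (?V j \<bullet> D j))) (at t within T)"
    unfolding cell_entropy_def
    by (intro DERIV_sum DERIV_cmult entropy_has_derivative D adm) auto
  also have "(\<Sum>j\<le>k. \<omega> j * ?h / 2 * (?V j \<bullet> D j)) = ?h / 2 * (\<Sum>j\<le>k. \<omega> j * (?V j \<bullet> D j))"
    by (simp add: sum_distrib_left algebra_simps)
  also have "\<dots> = - (entropy_flux_right \<alpha> k U t i - entropy_flux_left \<alpha> k U t i)"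
    unfolding total using h by (simp add: field_simps)
  finally show ?thesis .
qed

section \<open>Interface jumps and summation over the cells\<close>

lemma interface_entropy_flux_jump:
  assumes "entropy_stable_flux (lax_friedrichs \<alpha>)"
    and "U t i k \<in> admissible" "U t (i + 1) 0 \<in> admissible"
  shows "entropy_flux_left \<alpha> k U t (i + 1) \<le> entropy_flux_right \<alpha> k U t i"
proof -
  \<comment> \<open>Both neighbouring cells use the same numerical flux here, so the jump of the
    entropy flux is controlled by entropy stability at this interface.\<close>
  have "(entropy_var (U t (i + 1) 0) - entropy_var (U t i k)) \<bullet> interface_flux \<alpha> k U t i
      \<le> potential_flux (U t (i + 1) 0) - potential_flux (U t i k)"
    using assms unfolding entropy_stable_flux_def interface_flux_def by blast
  then show ?thesis
    by (simp add: entropy_flux_left_def entropy_flux_right_def inner_diff_left)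
qed

lemma boundary_entropy_flux_jump:
  assumes es: "entropy_stable_flux (lax_friedrichs \<alpha>)"
    and adm: "U t N k \<in> admissible" "U t 1 0 \<in> admissible"
    and bc: "periodic_bc N k T U \<or> compact_support_bc \<alpha> N k T U" and t: "t \<in> T"
  shows "entropy_flux_left \<alpha> k U t 1 \<le> entropy_flux_right \<alpha> k U t N"
  using bc
proof
  assume "periodic_bc N k T U"
  then have per: "U t 0 k = U t N k" "U t (N + 1) 0 = U t 1 0"
    using t by (auto simp: periodic_bc_def)
  \<comment> \<open>The exterior states make interface \<open>0\<close> a copy of interface
    \<open>N\<close>, so the periodic seam can be treated as an interior interface.\<close>
  then have "entropy_flux_left \<alpha> k U t (N + 1) = entropy_flux_left \<alpha> k U t 1"
    by (simp add: entropy_flux_left_def interface_flux_def)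
  then show ?thesis
    using interface_entropy_flux_jump[of \<alpha> U t N k, OF es adm(1)] adm(2) per by simp
next
  assume "compact_support_bc \<alpha> N k T U"
  then show ?thesis
    using t by (simp add: compact_support_bc_def)
qed

text \<open>Regrouping by interfaces pairs \<open>r i\<close> with \<open>l (i + 1)\<close>; each
  such pair contributes a nonpositive amount, and only the two boundary terms remain.\<close>

lemma sum_telescope_le:
  fixes l r :: "nat \<Rightarrow> real"
  assumes "N \<ge> 1" and "\<And>i. i \<in> {1..<N} \<Longrightarrow> l (i + 1) \<le> r i"
  shows "(\<Sum>i=1..N. l i - r i) \<le> l 1 - r N"
  using assms
proof (induction N rule: dec_induct)
  case base
  then show ?case by simp
next
  case (step n)
  then have "(\<Sum>i=1..n. l i - r i) \<le> l 1 - r n" "l (n + 1) \<le> r n"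
    by auto
  then show ?case by simp
qed

theorem theorem3p4:
  fixes a b :: real and N k :: nat
    and X \<omega> :: "nat \<Rightarrow> real"
    and \<phi> \<phi>x :: "real \<Rightarrow> real"
    and Ue :: "real \<Rightarrow> state"
    and FS :: "state \<Rightarrow> state \<Rightarrow> state"
    and \<alpha> :: "state \<Rightarrow> state \<Rightarrow> real"
    and T :: "real set"
    and U :: nodal_values
  assumes "a < b" and "N \<ge> 1" and "k \<ge> 1"
    and "gauss_lobatto k X \<omega>"
    and "\<And>x. x \<in> {a..b} \<Longrightarrow> (\<phi> has_real_derivative \<phi>x x) (at x within {a..b})"
    and "steady_state a b \<phi>x Ue"
    and "entropy_conservative_flux FS"
    and "entropy_stable_flux (lax_friedrichs \<alpha>)"
    and "is_interval T" and "interior T \<noteq> {}"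
    and "semidiscrete_solution a b N k X \<omega> FS \<alpha> \<phi>x Ue T U"
    and "periodic_bc N k T U \<or> compact_support_bc \<alpha> N k T U"
  shows "(\<forall>t\<in>T. \<forall>i\<in>{1..N}. correction_consistent a b N k X \<omega> FS \<phi>x Ue U t i \<longrightarrow>
            ((\<lambda>s. cell_entropy a b N k \<omega> U s i) has_real_derivative
               - (entropy_flux_right \<alpha> k U t i - entropy_flux_left \<alpha> k U t i)) (at t within T))
       \<and> (\<forall>t\<in>T. (\<forall>i\<in>{1..N}. correction_consistent a b N k X \<omega> FS \<phi>x Ue U t i) \<longrightarrow>
            (\<exists>D\<le>0. ((\<lambda>s. \<Sum>i=1..N. cell_entropy a b N k \<omega> U s i) has_real_derivative D)
                      (at t within T)))"
proof -
  have cell: "((\<lambda>s. cell_entropy a b N k \<omega> U s i) has_real_derivative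
      - (entropy_flux_right \<alpha> k U t i - entropy_flux_left \<alpha> k U t i)) (at t within T)"
    if "t \<in> T" "i \<in> {1..N}" "correction_consistent a b N k X \<omega> FS \<phi>x Ue U t i" for t i
    using cell_entropy_has_derivative assms that by blast
  have "\<exists>D\<le>0. ((\<lambda>s. \<Sum>i=1..N. cell_entropy a b N k \<omega> U s i) has_real_derivative D) (at t within T)"
    if t: "t \<in> T" and cc: "\<forall>i\<in>{1..N}. correction_consistent a b N k X \<omega> FS \<phi>x Ue U t i" for t
  proof (intro exI conjI)
    let ?l = "entropy_flux_left \<alpha> k U t" and ?r = "entropy_flux_right \<alpha> k U t"
    have adm: "U t i j \<in> admissible" if "i \<in> {1..N}" "j \<le> k" for i j
      using assms(11) t that by (auto simp: semidiscrete_solution_def)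
    \<comment> \<open>The witness for \<open>D\<close> is the sum of the cell balances; its sign
      follows by regrouping at the interfaces and closing with the boundary condition.\<close>
    show "((\<lambda>s. \<Sum>i=1..N. cell_entropy a b N k \<omega> U s i) has_real_derivative
        (\<Sum>i=1..N. - (?r i - ?l i))) (at t within T)"
      using cell t cc by (intro DERIV_sum) auto
    have "?l (i + 1) \<le> ?r i" if "i \<in> {1..<N}" for i
      using that by (intro interface_entropy_flux_jump assms(8) adm) auto
    then have "(\<Sum>i=1..N. ?l i - ?r i) \<le> ?l 1 - ?r N"
      by (rule sum_telescope_le[OF assms(2)])
    also have "\<dots> \<le> 0"
      using boundary_entropy_flux_jump[OF assms(8) adm adm assms(12) t] assms(2) by simp
    finally show "(\<Sum>i=1..N. - (?r i - ?l i)) \<le> 0"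
      by simp
  qed
  with cell show ?thesis by blast
qed

end
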